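(* Let $(Z,d,\nu)$ be a bounded Ahlfors--David $D$-regular metric measure space, and let $1\le p<\infty$. Then there is a constant $C>0$, depending only on $(Z,d,\nu)$ and $p$, such that for any measurable function $f:Z\to\mathbb{C}$ we have $$\int_Z |f|^p\log^+\frac{|f|^p}{\|f|L^p\|^p}\,\mathrm{d}\nu\ \le\ C\left(\|f|L^p\|^p+\iint_{Z^2}\frac{|f(\xi)-f(\eta)|^p}{d^D(\xi,\eta)}\,\mathrm{d}\nu(\xi)\mathrm{d}\nu(\eta)\right)$$ (the inequality being understood to hold trivially if the right-hand side is infinite or if $f=0$ a.e.).
   Context: A bounded metric measure space $(Z,d,\nu)$ is Ahlfors--David $D$-regular ($D\ge0$) if there are constants $0<c\le 1\le C'$ with $cr^D\le\nu(B(\xi,r))\le C'r^D$ for all $\xi\in Z$ and $0\le r\le\operatorname{diam}(Z)$, where $B(\xi,r)$ is the closed ball. $\log^+(s)=\max(0,\log s)$ for $s>0$ (natural logarithm), $\log^+(0)=0$. $\|f|L^p\|$ is the norm of $f$ in $L^p(Z,\nu)$. *)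

theory Defs
  imports "HOL-Analysis.Analysis"
begin

(* HOL has 0 powr 0 = 0. The regularity condition includes r = 0 and D = 0, where r^D is read
   as 1: a 0-regular space is one whose points have mass bounded away from 0. *)
definition rpow :: "real \<Rightarrow> real \<Rightarrow> real" where
  "rpow r a = (if a = 0 then 1 else r powr a)"

(* A metric measure space is a metric space type with a measure on a sigma-algebra containing
   the Borel sets; this admits Borel measures as well as their completions. *)
definition metric_measure_space :: "'a::metric_space measure \<Rightarrow> bool" where
  "metric_measure_space \<nu> \<longleftrightarrow> sets borel \<subseteq> sets \<nu>"

definition Ahlfors_David_regular :: "'a::metric_space measure \<Rightarrow> real \<Rightarrow> bool" where
  "Ahlfors_David_regular \<nu> D \<longleftrightarrow>
     0 \<le> D \<and>
     (\<exists>c C'. 0 < c \<and> c \<le> 1 \<and> 1 \<le> C' \<and>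
        (\<forall>\<xi>. \<forall>r\<in>{0..diameter (UNIV :: 'a set)}.
           ennreal (c * rpow r D) \<le> emeasure \<nu> (cball \<xi> r) \<and>
           emeasure \<nu> (cball \<xi> r) \<le> ennreal (C' * rpow r D)))"

definition log_plus :: "real \<Rightarrow> real" where
  "log_plus s = (if s = 0 then 0 else max 0 (ln s))"

(* Real powers on [0, \<infinity>], used for positive exponents only. *)
definition ennreal_powr :: "ennreal \<Rightarrow> real \<Rightarrow> ennreal" where
  "ennreal_powr x a = (if x = \<infinity> then \<infinity> else ennreal (enn2real x powr a))"

definition Lp_norm :: "'a measure \<Rightarrow> real \<Rightarrow> ('a \<Rightarrow> complex) \<Rightarrow> ennreal" where
  "Lp_norm \<nu> p f = ennreal_powr (\<integral>\<^sup>+ \<xi>. ennreal (norm (f \<xi>) powr p) \<partial>\<nu>) (1 / p)"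

(* enn2real sends \<infinity> to 0 and x / 0 = 0 in HOL, so this has its intended meaning when the
   L^p norm is finite and nonzero. The values in the two remaining cases are immaterial for the
   inequality: an infinite norm makes the right-hand side infinite, and a zero norm means that
   the integrand vanishes almost everywhere. *)
definition log_integral :: "'a measure \<Rightarrow> real \<Rightarrow> ('a \<Rightarrow> complex) \<Rightarrow> ennreal" where
  "log_integral \<nu> p f =
     (\<integral>\<^sup>+ \<xi>. ennreal (norm (f \<xi>) powr p *
        log_plus (norm (f \<xi>) powr p / enn2real (Lp_norm \<nu> p f) powr p)) \<partial>\<nu>)"

(* On the diagonal the integrand is 0: there the numerator is 0, and 0 / 0 = 0 in HOL. *)
definition double_integral ::
    "'a::metric_space measure \<Rightarrow> real \<Rightarrow> real \<Rightarrow> ('a \<Rightarrow> complex) \<Rightarrow> ennreal" where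
  "double_integral \<nu> D p f =
     (\<integral>\<^sup>+ (\<xi>, \<eta>). ennreal (norm (f \<xi> - f \<eta>) powr p / rpow (dist \<xi> \<eta>) D) \<partial>(\<nu> \<Otimes>\<^sub>M \<nu>))"

end

theory Submission
  imports Defs
begin

text \<open>
  The inequality is the integral over \<open>\<xi>\<close> of a pointwise one. Write \<open>a\<close> for the integral
  of \<open>|f|^p\<close>, assumed finite and positive, and fix \<open>\<xi>\<close> with \<open>s = |f \<xi>| > 0\<close>. By Markov's
  inequality the set \<open>A\<close> where \<open>|f| > s/2\<close> has mass at most \<open>m = 2^p a / s^p\<close>, and off \<open>A\<close>
  we have \<open>|f \<xi> - f \<eta>| \<ge> s/2\<close>. Hence the inner integral of the difference quotient at
  \<open>\<xi>\<close> is at least \<open>(s/2)^p\<close> times the integral of \<open>dist \<xi> \<eta> powr -D\<close> over the complement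
  of \<open>A\<close>.

  For \<open>D > 0\<close> that last integral is at least a multiple of \<open>ln (1/m)\<close>, up to a constant factor
  inside the logarithm (\<open>kernel_integral_off_set\<close>). Indeed, regularity makes the kernel
  contribute a fixed amount on each annulus around \<open>\<xi>\<close> of a suitable fixed ratio, and a set of
  mass \<open>m\<close> can spoil only the annuli whose own mass is comparable to \<open>m\<close> or smaller; the masses
  decay geometrically, so the number of those left grows like \<open>ln (1/m)\<close>.
  Since \<open>1/m\<close> is a multiple of \<open>s^p / a\<close>, this bounds
  \<open>s^p ln (s^p / a)\<close> by a multiple of \<open>s^p\<close> plus the inner integral
  (\<open>pointwise_log_bound_diffuse\<close>).

  For \<open>D = 0\<close> every point is an atom of mass at least \<open>c\<close>, so \<open>s^p / a \<le> 1/c\<close> and the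
  logarithm is bounded outright (\<open>pointwise_log_bound_atomic\<close>).

  Integrating over \<open>\<xi>\<close> uses Tonelli's theorem, hence measurability of the distance for the
  product sigma-algebra. This is not automatic in a metric space, but the space is separable: balls of
  a given radius have mass bounded below and the total mass is finite, so separated sets are
  finite.
\<close>

section \<open>Separability and measurability of the distance\<close>

text \<open>
  Balls of radius \<open>e/3\<close> around \<open>e\<close>-separated points are disjoint, so the total mass bounds the
  size of an \<open>e\<close>-separated set; one of maximal size is an \<open>e\<close>-net.
\<close>

lemma countable_dense_if_balls_have_mass:
  fixes M :: "'a::metric_space measure"
  assumes "finite_measure M" and borel: "sets borel \<subseteq> sets M"
    and mass: "\<And>r. 0 < r \<Longrightarrow> \<exists>b>0. \<forall>x. b \<le> measure M (cball x r)"
  shows "\<exists>Q::'a set. countable Q \<and> (\<forall>x. \<forall>e>0. \<exists>q\<in>Q. dist x q < e)"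
proof -
  interpret finite_measure M by fact
  have net: "\<exists>S::'a set. finite S \<and> (\<forall>x. \<exists>q\<in>S. dist x q < e)" if e: "0 < e" for e :: real
  proof -
    define sep where "sep S \<longleftrightarrow> finite S \<and> (\<forall>x\<in>S. \<forall>y\<in>S. x \<noteq> y \<longrightarrow> e \<le> dist x y)" for S :: "'a set"
    obtain b where b: "b > 0" "\<And>x. b \<le> measure M (cball x (e / 3))"
      using mass[of "e / 3"] e by auto
    have bound: "card S \<le> nat \<lfloor>measure M (space M) / b\<rfloor>" if "sep S" for S
    proof -
      have disj: "disjoint_family_on (\<lambda>x. cball x (e / 3)) S"
      proof (unfold disjoint_family_on_def, intro ballI impI equals0I)
        fix x y z assume "x \<in> S" "y \<in> S" "x \<noteq> y" "z \<in> cball x (e / 3) \<inter> cball y (e / 3)"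
        moreover from this have "e \<le> dist x y" using \<open>sep S\<close> by (auto simp: sep_def)
        moreover have "dist x y \<le> dist x z + dist y z"
          by (rule dist_triangle2)
        ultimately show False using e by auto
      qed
      have "real (card S) * b \<le> (\<Sum>x\<in>S. measure M (cball x (e / 3)))"
        using sum_mono[of S "\<lambda>_. b" "\<lambda>x. measure M (cball x (e / 3))"] b by simp
      also have "\<dots> = measure M (\<Union>x\<in>S. cball x (e / 3))"
        using \<open>sep S\<close> disj borel
        by (intro finite_measure_finite_Union[symmetric]) (auto simp: sep_def)
      also have "\<dots> \<le> measure M (space M)"
        by (rule bounded_measure)
      finally show ?thesis
        using b by (simp add: le_nat_iff le_floor_iff field_simps)
    qed
    have "sep {}" by (simp add: sep_def)
    moreover have "\<forall>S. sep S \<longrightarrow> card S < Suc (nat \<lfloor>measure M (space M) / b\<rfloor>)"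
      using bound by (simp add: less_Suc_eq_le)
    ultimately have "\<exists>S. sep S \<and> (\<forall>T. sep T \<longrightarrow> card T \<le> card S)"
      by (rule ex_has_greatest_nat)
    then obtain S where S: "sep S" "\<And>T. sep T \<Longrightarrow> card T \<le> card S"
      by auto
    have "\<exists>q\<in>S. dist x q < e" for x
    proof (rule ccontr)
      assume far: "\<not> (\<exists>q\<in>S. dist x q < e)"
      then have "x \<notin> S" using e by force
      moreover have "sep (insert x S)"
        using S(1) far by (auto simp: sep_def dist_commute not_less)
      ultimately show False
        using S(2)[of "insert x S"] S(1) by (auto simp: sep_def)
    qed
    then show ?thesis using S(1) by (auto simp: sep_def)
  qed
  have "\<forall>n. \<exists>S::'a set. finite S \<and> (\<forall>x. \<exists>q\<in>S. dist x q < inverse (real (Suc n)))"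
    using net by simp
  then obtain S :: "nat \<Rightarrow> 'a set"
    where S: "\<And>n. finite (S n)" "\<And>n x. \<exists>q\<in>S n. dist x q < inverse (real (Suc n))"
    by metis
  show ?thesis
  proof (intro exI conjI allI impI)
    show "countable (\<Union>n. S n)" using S(1) by (simp add: countable_finite)
    fix x and e :: real assume "0 < e"
    then obtain n where "inverse (real (Suc n)) < e" using reals_Archimedean by blast
    with S(2)[of n x] show "\<exists>q\<in>\<Union>n. S n. dist x q < e" by force
  qed
qed

text \<open>
  With a dense set \<open>Q\<close>, the distance is the infimum over \<open>q \<in> Q\<close> of the length of the detour
  through \<open>q\<close>, a countable infimum of sums of functions of one variable each.
\<close>

lemma measurable_dist_of_countable_dense:
  fixes M :: "'a::metric_space measure" and Q :: "'a set"
  assumes borel: "sets borel \<subseteq> sets M"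
    and Q: "countable Q" "\<And>x e. 0 < e \<Longrightarrow> \<exists>q\<in>Q. dist x q < e"
  shows "(\<lambda>(x, y). dist x y) \<in> borel_measurable (M \<Otimes>\<^sub>M M)"
proof -
  have sp: "space M = UNIV"
    using borel sets.sets_into_space[of UNIV M] by force
  have [measurable]: "(\<lambda>x. dist x q) \<in> borel_measurable M" for q
    by (rule borel_measurable_subalgebra[OF borel]) (auto simp: sp intro!: borel_measurable_continuous_onI continuous_on_dist continuous_on_id continuous_on_const)
  have "Q \<noteq> {}" using Q(2)[of 1] by auto
  have bdd: "bdd_below ((\<lambda>q. dist x q + dist y q) ` Q)" for x y
    by (rule bdd_belowI[of _ 0]) auto
  have eq: "dist x y = (INF q\<in>Q. dist x q + dist y q)" for x y
  proof (rule antisym)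
    show "dist x y \<le> (INF q\<in>Q. dist x q + dist y q)"
      using \<open>Q \<noteq> {}\<close> by (rule cINF_greatest) (rule dist_triangle2)
    show "(INF q\<in>Q. dist x q + dist y q) \<le> dist x y"
    proof (rule field_le_epsilon)
      fix e :: real assume "0 < e"
      then obtain q where q: "q \<in> Q" "dist x q < e / 2" using Q(2)[of "e / 2" x] by auto
      have "(INF q\<in>Q. dist x q + dist y q) \<le> dist x q + dist y q"
        using q(1) bdd by (rule cINF_lower[rotated])
      also have "\<dots> \<le> dist x y + e"
        using q(2) dist_triangle[of y q x] by (simp add: dist_commute)
      finally show "(INF q\<in>Q. dist x q + dist y q) \<le> dist x y + e" .
    qed
  qed
  have "(\<lambda>z. INF q\<in>Q. dist (fst z) q + dist (snd z) q) \<in> borel_measurable (M \<Otimes>\<^sub>M M)"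
    using Q(1) bdd by (intro borel_measurable_cINF) auto
  moreover have "(\<lambda>(x, y). dist x y) = (\<lambda>z. INF q\<in>Q. dist (fst z) q + dist (snd z) q)"
    by (auto simp: fun_eq_iff intro: eq)
  ultimately show ?thesis by simp
qed

section \<open>Ahlfors--David regular measures\<close>

text \<open>
  Ahlfors--David regularity with its two constants fixed, so that the final constant can be written
  in terms of them; \<open>\<Delta>\<close> stands for the diameter.
\<close>

locale regular_measure =
  fixes \<nu> :: "'a::metric_space measure" and D c C' \<Delta> :: real
  assumes borel_sets: "sets borel \<subseteq> sets \<nu>"
    and dist_le: "dist (x::'a) y \<le> \<Delta>"
    and D_nonneg: "0 \<le> D"
    and c_pos: "0 < c" and c_le_1: "c \<le> 1" and C'_ge_1: "1 \<le> C'"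
    and lower_mass: "0 \<le> r \<Longrightarrow> r \<le> \<Delta> \<Longrightarrow> ennreal (c * rpow r D) \<le> emeasure \<nu> (cball \<xi> r)"
    and upper_mass: "0 \<le> r \<Longrightarrow> r \<le> \<Delta> \<Longrightarrow> emeasure \<nu> (cball \<xi> r) \<le> ennreal (C' * rpow r D)"
begin

lemma diam_nonneg: "0 \<le> \<Delta>"
  using dist_le[of undefined undefined] by simp

lemma space_eq_UNIV [simp]: "space \<nu> = UNIV"
  using borel_sets sets.sets_into_space[of UNIV \<nu>] by force

lemma borel_in_sets: "A \<in> sets borel \<Longrightarrow> A \<in> sets \<nu>"
  using borel_sets by blast

lemma whole_space_is_ball: "cball (\<xi>::'a) \<Delta> = UNIV"
  using dist_le by auto

lemma finite_measure: "finite_measure \<nu>"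
proof
  have "emeasure \<nu> (space \<nu>) \<le> ennreal (C' * rpow \<Delta> D)"
    using upper_mass[of \<Delta> undefined] diam_nonneg by (simp add: whole_space_is_ball)
  then show "emeasure \<nu> (space \<nu>) \<noteq> \<infinity>"
    by (auto simp: top_unique)
qed

sublocale finite_measure \<nu> by (rule finite_measure)

lemma measure_ball_bounds:
  assumes "0 \<le> r" "r \<le> \<Delta>"
  shows "c * rpow r D \<le> measure \<nu> (cball \<xi> r)" "measure \<nu> (cball \<xi> r) \<le> C' * rpow r D"
proof -
  have "0 \<le> C' * rpow r D" using C'_ge_1 by (auto simp: rpow_def)
  then show "measure \<nu> (cball \<xi> r) \<le> C' * rpow r D"
    using upper_mass[OF assms, of \<xi>] by (simp add: emeasure_eq_measure)
  show "c * rpow r D \<le> measure \<nu> (cball \<xi> r)"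
    using lower_mass[OF assms, of \<xi>] by (simp add: emeasure_eq_measure)
qed

lemma mass_pos_of_integral_pos:
  assumes "(\<integral>\<^sup>+\<eta>. g \<eta> \<partial>\<nu>) \<noteq> 0"
  shows "emeasure \<nu> UNIV \<noteq> 0"
proof
  assume "emeasure \<nu> UNIV = 0"
  then have "AE \<eta> in \<nu>. g \<eta> = 0"
    by (intro AE_I[of _ _ UNIV] borel_in_sets) auto
  then have "(\<integral>\<^sup>+\<eta>. g \<eta> \<partial>\<nu>) = (\<integral>\<^sup>+\<eta>. 0 \<partial>\<nu>)"
    by (rule nn_integral_cong_AE)
  with assms show False by simp
qed

text \<open>
  A one-point space satisfies the regularity condition for \<open>D > 0\<close> only with the zero measure; this
  case has to be excluded before positive radii up to the diameter can be used.
\<close>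

lemma diam_pos:
  assumes "0 < D" "emeasure \<nu> UNIV \<noteq> 0"
  shows "0 < \<Delta>"
proof (rule ccontr)
  assume "\<not> 0 < \<Delta>"
  then have "\<Delta> = 0" using diam_nonneg by simp
  then have "emeasure \<nu> UNIV \<le> ennreal (C' * rpow 0 D)"
    using upper_mass[of 0 undefined] whole_space_is_ball[of undefined] by simp
  then show False using assms by (simp add: rpow_def)
qed

lemma dist_measurable:
  assumes "emeasure \<nu> UNIV \<noteq> 0"
  shows "(\<lambda>(x, y). dist x y) \<in> borel_measurable (\<nu> \<Otimes>\<^sub>M \<nu>)"
proof -
  have "\<exists>b>0. \<forall>x. b \<le> measure \<nu> (cball x r)" if "0 < r" for r
  proof (intro exI conjI allI)
    (* Beyond the diameter regularity says nothing, so larger radii are cut down to it. *)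
    show "0 < c * rpow (min r \<Delta>) D"
      using that c_pos D_nonneg diam_pos assms by (auto simp: rpow_def min_def)
    fix x
    have "c * rpow (min r \<Delta>) D \<le> measure \<nu> (cball x (min r \<Delta>))"
      using that diam_nonneg by (intro measure_ball_bounds) auto
    also have "\<dots> \<le> measure \<nu> (cball x r)"
      by (intro finite_measure_mono borel_in_sets) auto
    finally show "c * rpow (min r \<Delta>) D \<le> measure \<nu> (cball x r)" .
  qed
  then have "\<exists>Q::'a set. countable Q \<and> (\<forall>x. \<forall>e>0. \<exists>q\<in>Q. dist x q < e)"
    by (rule countable_dense_if_balls_have_mass[OF finite_measure borel_sets])
  then obtain Q :: "'a set" where Q: "countable Q" "\<forall>x. \<forall>e>0. \<exists>q\<in>Q. dist x q < e"
    by (elim exE conjE)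
  show ?thesis
    by (rule measurable_dist_of_countable_dense[OF borel_sets Q(1)]) (simp add: Q(2))
qed

lemma kernel_measurable:
  "(\<lambda>\<eta>. ennreal (1 / rpow (dist \<xi> \<eta>) D)) \<in> borel_measurable \<nu>"
proof (rule borel_measurable_subalgebra[OF borel_sets])
  have "(\<lambda>\<eta>. dist \<xi> \<eta>) \<in> borel_measurable borel"
    by (intro borel_measurable_continuous_onI continuous_on_dist continuous_on_const continuous_on_id)
  then have "(\<lambda>\<eta>. dist \<xi> \<eta> powr D) \<in> borel_measurable borel"
    by measurable
  then show "(\<lambda>\<eta>. ennreal (1 / rpow (dist \<xi> \<eta>) D)) \<in> borel_measurable borel"
    unfolding rpow_def by (cases "D = 0") auto
qed simp

section \<open>The kernel off a small set\<close>

text \<open>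
  On annuli around \<open>\<xi>\<close> of ratio \<open>q powr (1/D)\<close>, with \<open>q = 2 C'/c\<close>, the outer ball has at
  least twice the mass of the inner one, so the \<open>k\<close>-th annulus has mass at least
  \<open>(c/2) \<Delta>^D / q^k\<close>, while the kernel there is at least \<open>q^k / \<Delta>^D\<close>. As long as \<open>m\<close> is at most
  half of that mass, that is \<open>q^k \<le> c \<Delta>^D / (4 m)\<close>, removing \<open>A\<close> leaves a contribution of at
  least \<open>c/4\<close>. Counting such \<open>k\<close> gives the logarithm. For large \<open>m\<close> the logarithm is
  negative and the claim is trivial, since \<open>ennreal\<close> sends negative numbers to \<open>0\<close>.
\<close>

lemma kernel_integral_off_set:
  assumes D: "0 < D" and diam: "0 < \<Delta>"
    and A: "A \<in> sets \<nu>" "measure \<nu> A \<le> m" and m: "0 < m"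
  shows "ennreal (c / 4 * (ln (c * \<Delta> powr D / (4 * m)) / ln (2 * C' / c)))
    \<le> (\<integral>\<^sup>+\<eta>\<in>- A. ennreal (1 / rpow (dist \<xi> \<eta>) D) \<partial>\<nu>)"
proof -
  define q where "q = 2 * C' / c"
  have q: "1 < q" unfolding q_def using c_pos c_le_1 C'_ge_1 by (simp add: field_simps)
  define X where "X = c * \<Delta> powr D / (4 * m)"
  have X: "0 < X" unfolding X_def using c_pos diam m by simp
  define r where "r k = \<Delta> * q powr (- real k / D)" for k
  have r_pos: "0 < r k" for k using diam q by (simp add: r_def)
  have r_le: "r k \<le> \<Delta>" for k
    using diam q D powr_mono[of "- real k / D" 0 q] by (simp add: r_def)
  have r_mono: "r l \<le> r k" if "k \<le> l" for k l
    using diam q D that unfolding r_def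
    by (intro mult_left_mono powr_mono) (auto simp: divide_right_mono)
  have r_powr: "r k powr D = \<Delta> powr D / q ^ k" for k
  proof -
    have "r k powr D = \<Delta> powr D * q powr (- real k)"
      using diam D by (simp add: r_def powr_mult powr_powr)
    then show ?thesis using q by (simp add: powr_minus powr_realpow divide_inverse)
  qed
  define E where "E k = cball \<xi> (r k) - cball \<xi> (r (Suc k))" for k
  have E_sets: "E k \<in> sets \<nu>" for k
    unfolding E_def by (intro sets.Diff borel_in_sets) auto
  define g where "g \<eta> = ennreal (1 / rpow (dist \<xi> \<eta>) D)" for \<eta>
  have g: "g \<in> borel_measurable \<nu>" unfolding g_def by (rule kernel_measurable)
  have annulus: "ennreal (c / 4) \<le> emeasure (density \<nu> g) (E k - A)" if k: "q ^ k \<le> X" for k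
  proof -
    let ?w = "q ^ k / \<Delta> powr D"
    have w: "0 < ?w" using q diam by simp
    have "c * (\<Delta> powr D / q ^ k) \<le> measure \<nu> (cball \<xi> (r k))"
      using measure_ball_bounds(1)[of "r k" \<xi>] r_pos[of k] r_le[of k] D by (simp add: rpow_def r_powr)
    moreover have "measure \<nu> (cball \<xi> (r (Suc k))) \<le> c / 2 * (\<Delta> powr D / q ^ k)"
      using measure_ball_bounds(2)[of "r (Suc k)" \<xi>] r_pos[of "Suc k"] r_le[of "Suc k"] D C'_ge_1 c_pos
      by (simp add: rpow_def r_powr) (simp add: q_def field_simps)
    moreover have "measure \<nu> (E k) = measure \<nu> (cball \<xi> (r k)) - measure \<nu> (cball \<xi> (r (Suc k)))"
      unfolding E_def using r_mono[of k "Suc k"] by (intro finite_measure_Diff borel_in_sets) auto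
    moreover have "measure \<nu> (E k) \<le> measure \<nu> ((E k - A) \<union> A)"
      using E_sets A by (intro finite_measure_mono) auto
    moreover have "measure \<nu> ((E k - A) \<union> A) \<le> measure \<nu> (E k - A) + measure \<nu> A"
      using E_sets A by (intro measure_Un_le) auto
    moreover have "m \<le> c / 4 * (\<Delta> powr D / q ^ k)"
      using k m q by (simp add: X_def field_simps)
    ultimately have "c / 4 * (\<Delta> powr D / q ^ k) \<le> measure \<nu> (E k - A)"
      using A(2) by (simp add: algebra_simps)
    then have "c / 4 \<le> ?w * measure \<nu> (E k - A)"
      using q diam by (simp add: field_simps)
    then have "ennreal (c / 4) \<le> ennreal (?w * measure \<nu> (E k - A))"
      by (rule ennreal_leI)
    also have "\<dots> = ennreal ?w * emeasure \<nu> (E k - A)"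
      unfolding emeasure_eq_measure using w by (intro ennreal_mult) auto
    also have "\<dots> = (\<integral>\<^sup>+\<eta>. ennreal ?w * indicator (E k - A) \<eta> \<partial>\<nu>)"
      using E_sets A by (intro nn_integral_cmult_indicator[symmetric]) auto
    also have "\<dots> \<le> (\<integral>\<^sup>+\<eta>. g \<eta> * indicator (E k - A) \<eta> \<partial>\<nu>)"
    proof (rule nn_integral_mono)
      fix \<eta>
      show "ennreal ?w * indicator (E k - A) \<eta> \<le> g \<eta> * indicator (E k - A) \<eta>"
      proof (cases "\<eta> \<in> E k - A")
        case True
        then have d: "dist \<xi> \<eta> \<le> r k" "0 < dist \<xi> \<eta>"
          using r_pos[of "Suc k"] by (auto simp: E_def)
        then have "dist \<xi> \<eta> powr D \<le> \<Delta> powr D / q ^ k"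
          using D powr_mono2[of D "dist \<xi> \<eta>" "r k"] by (simp add: r_powr)
        then have "?w \<le> 1 / dist \<xi> \<eta> powr D"
          using d q diam by (simp add: field_simps)
        then show ?thesis using True D by (simp add: g_def rpow_def ennreal_leI)
      qed simp
    qed
    also have "\<dots> = emeasure (density \<nu> g) (E k - A)"
      using E_sets A g by (intro emeasure_density[symmetric]) auto
    finally show ?thesis .
  qed
  have disj: "disjoint_family (\<lambda>k. E k - A)"
  proof (unfold disjoint_family_on_def, intro ballI impI)
    have less: "(E k - A) \<inter> (E l - A) = {}" if "k < l" for k l
      using r_mono[of "Suc k" l] that by (auto simp: E_def)
    fix k l :: nat assume "k \<noteq> l"
    then show "(E k - A) \<inter> (E l - A) = {}"
      using less[of k l] less[of l k] by (cases "k < l") auto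
  qed
  have total: "ennreal (c / 4 * (ln X / ln q)) \<le> emeasure (density \<nu> g) (- A)"
  proof (cases "1 \<le> X")
    case False
    then have "c / 4 * (ln X / ln q) \<le> 0"
      using X q c_pos by (simp add: mult_le_0_iff divide_le_0_iff)
    then show ?thesis by (simp add: ennreal_neg)
  next
    case True
    (* The number of indices k with q ^ k at most X, counting k = 0. *)
    define N where "N = Suc (nat \<lfloor>ln X / ln q\<rfloor>)"
    have "0 \<le> ln X / ln q" using True q by simp
    then have N: "ln X / ln q \<le> real N" "\<And>k. k < N \<Longrightarrow> real k \<le> ln X / ln q"
      unfolding N_def by linarith+
    have qk: "q ^ k \<le> X" if "k < N" for k
    proof -
      have "ln (q ^ k) \<le> ln X" using N(2)[OF that] q by (simp add: ln_realpow field_simps)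
      then show ?thesis using q X by simp
    qed
    have "ennreal (c / 4 * (ln X / ln q)) \<le> ennreal (real N * (c / 4))"
      using mult_left_mono[OF N(1), of "c / 4"] c_pos by (intro ennreal_leI) (simp add: mult.commute)
    also have "\<dots> = (\<Sum>k<N. ennreal (c / 4))"
      using c_pos by (subst ennreal_mult) (auto simp: ennreal_of_nat_eq_real_of_nat)
    also have "\<dots> \<le> (\<Sum>k<N. emeasure (density \<nu> g) (E k - A))"
      by (intro sum_mono annulus qk) auto
    also have "\<dots> = emeasure (density \<nu> g) (\<Union>k<N. E k - A)"
      using E_sets A disj by (intro sum_emeasure) (auto simp: disjoint_family_on_def)
    also have "\<dots> \<le> emeasure (density \<nu> g) (- A)"
      using A sets.compl_sets[OF A(1)] by (intro emeasure_mono) (auto simp: Compl_eq_Diff_UNIV)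
    finally show ?thesis .
  qed
  also have "emeasure (density \<nu> g) (- A) = (\<integral>\<^sup>+\<eta>\<in>- A. g \<eta> \<partial>\<nu>)"
    using A sets.compl_sets[OF A(1)] g by (intro emeasure_density) (auto simp: Compl_eq_Diff_UNIV)
  finally show ?thesis by (simp add: X_def q_def g_def)
qed

section \<open>The pointwise inequality\<close>

text \<open>
  The ball of radius \<open>0\<close> around \<open>\<xi>\<close> is \<open>{\<xi>}\<close>, and \<open>rpow 0 0 = 1\<close>; so \<open>\<xi>\<close> alone
  contributes at least \<open>c |f \<xi>|^p\<close> to the integral of \<open>|f|^p\<close>.
\<close>

lemma pointwise_log_bound_atomic:
  fixes f :: "'a \<Rightarrow> complex"
  assumes D: "D = 0" and a: "0 < a" "(\<integral>\<^sup>+\<eta>. ennreal (norm (f \<eta>) powr p) \<partial>\<nu>) = ennreal a"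
  shows "norm (f \<xi>) powr p * log_plus (norm (f \<xi>) powr p / a) \<le> ln (1 / c) * norm (f \<xi>) powr p"
proof -
  let ?t = "norm (f \<xi>) powr p"
  have atom: "c \<le> measure \<nu> {\<xi>}"
    using measure_ball_bounds(1)[of 0 \<xi>] diam_nonneg D by (simp add: rpow_def)
  have "ennreal (?t * c) \<le> ennreal ?t * emeasure \<nu> {\<xi>}"
    using atom by (simp add: emeasure_eq_measure flip: ennreal_mult) (intro ennreal_leI mult_left_mono, auto)
  also have "\<dots> = (\<integral>\<^sup>+\<eta>. ennreal ?t * indicator {\<xi>} \<eta> \<partial>\<nu>)"
    by (intro nn_integral_cmult_indicator[symmetric] borel_in_sets) auto
  also have "\<dots> \<le> (\<integral>\<^sup>+\<eta>. ennreal (norm (f \<eta>) powr p) \<partial>\<nu>)"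
    by (intro nn_integral_mono) (auto simp: indicator_def)
  finally have "?t * c \<le> a" using a by simp
  then have "?t / a \<le> 1 / c" using a c_pos by (simp add: field_simps)
  moreover have "0 \<le> ln (1 / c)" using c_pos c_le_1 by simp
  moreover have "0 \<le> ?t / a" using a by simp
  ultimately have "log_plus (?t / a) \<le> ln (1 / c)"
    unfolding log_plus_def using ln_mono[of "?t / a" "1 / c"] a by (auto simp del: ln_div ln_divide_pos simp: less_le)
  then show ?thesis by (metis mult.commute mult_left_mono powr_ge_zero)
qed

text \<open>
  The kernel estimate is used with \<open>A = {\<eta>. |f \<eta>| > s/2}\<close> and \<open>m = 2^p a / s^p\<close>. The first
  summand of \<open>K\<close> absorbs the constant factor between \<open>s^p / a\<close> and the argument of the logarithm
  in that estimate; the second is the reciprocal of the remaining factors.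
\<close>

lemma pointwise_log_bound_diffuse:
  fixes f :: "'a \<Rightarrow> complex"
  assumes D: "0 < D" and p: "1 \<le> p" and f: "f \<in> borel_measurable \<nu>"
    and a: "0 < a" "(\<integral>\<^sup>+\<eta>. ennreal (norm (f \<eta>) powr p) \<partial>\<nu>) = ennreal a"
  defines "K \<equiv> \<bar>ln (c * \<Delta> powr D / (4 * 2 powr p))\<bar> + 4 * 2 powr p * ln (2 * C' / c) / c"
  shows "ennreal (norm (f \<xi>) powr p * log_plus (norm (f \<xi>) powr p / a))
    \<le> ennreal K * (ennreal (norm (f \<xi>) powr p)
        + (\<integral>\<^sup>+\<eta>. ennreal (norm (f \<xi> - f \<eta>) powr p / rpow (dist \<xi> \<eta>) D) \<partial>\<nu>))"
proof (cases "f \<xi> = 0")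
  case True
  then show ?thesis by simp
next
  case False
  define s where "s = norm (f \<xi>)"
  define t where "t = s powr p"
  define \<kappa> where "\<kappa> = c * \<Delta> powr D / (4 * 2 powr p)"
  define m where "m = 2 powr p * a / t"
  define b where "b = c / 4 * (ln (\<kappa> * (t / a)) / ln (2 * C' / c))"
  define J where "J = (\<integral>\<^sup>+\<eta>. ennreal (norm (f \<xi> - f \<eta>) powr p / rpow (dist \<xi> \<eta>) D) \<partial>\<nu>)"
  have s: "0 < s" using False by (simp add: s_def)
  then have t: "0 < t" by (simp add: t_def)
  have half: "(s / 2) powr p = t / 2 powr p" using s by (simp add: t_def powr_divide)
  have "emeasure \<nu> UNIV \<noteq> 0"
    using a by (intro mass_pos_of_integral_pos[of "\<lambda>\<eta>. ennreal (norm (f \<eta>) powr p)"]) simp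
  then have diam: "0 < \<Delta>" using diam_pos D by simp
  then have \<kappa>: "0 < \<kappa>" using c_pos by (simp add: \<kappa>_def)
  have q: "1 < 2 * C' / c" using c_pos c_le_1 C'_ge_1 by (simp add: field_simps)
  define A where "A = {\<eta>. s / 2 < norm (f \<eta>)}"
  have A: "A \<in> sets \<nu>"
  proof -
    have "{\<eta> \<in> space \<nu>. s / 2 < norm (f \<eta>)} \<in> sets \<nu>" using f by measurable
    then show ?thesis by (simp add: A_def)
  qed
  (* Markov's inequality for |f|^p at height (s/2)^p. *)
  have "ennreal (t / 2 powr p * measure \<nu> A) = ennreal (t / 2 powr p) * emeasure \<nu> A"
    unfolding emeasure_eq_measure using t by (intro ennreal_mult) auto
  also have "\<dots> = (\<integral>\<^sup>+\<eta>. ennreal (t / 2 powr p) * indicator A \<eta> \<partial>\<nu>)"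
    using A by (rule nn_integral_cmult_indicator[symmetric])
  also have "\<dots> \<le> (\<integral>\<^sup>+\<eta>. ennreal (norm (f \<eta>) powr p) \<partial>\<nu>)"
    using s p by (intro nn_integral_mono)
      (auto simp: indicator_def A_def half[symmetric] intro!: ennreal_leI powr_mono2)
  finally have "t / 2 powr p * measure \<nu> A \<le> a" using a by simp
  then have A_small: "measure \<nu> A \<le> m" using t by (simp add: m_def field_simps)
  have m: "0 < m" using t a by (simp add: m_def)
  have "c * \<Delta> powr D / (4 * m) = \<kappa> * (t / a)"
    using t a by (simp add: m_def \<kappa>_def field_simps)
  then have kernel: "ennreal b \<le> (\<integral>\<^sup>+\<eta>\<in>- A. ennreal (1 / rpow (dist \<xi> \<eta>) D) \<partial>\<nu>)"
    using kernel_integral_off_set[OF D diam A A_small m, of \<xi>] by (simp add: b_def)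
  have "ennreal (t / 2 powr p) * ennreal b
      \<le> ennreal (t / 2 powr p) * (\<integral>\<^sup>+\<eta>\<in>- A. ennreal (1 / rpow (dist \<xi> \<eta>) D) \<partial>\<nu>)"
    using kernel by (rule mult_left_mono) simp
  also have "\<dots> = (\<integral>\<^sup>+\<eta>. ennreal (t / 2 powr p) * (ennreal (1 / rpow (dist \<xi> \<eta>) D) * indicator (- A) \<eta>) \<partial>\<nu>)"
  proof (rule nn_integral_cmult[symmetric])
    have "- A \<in> sets \<nu>" using sets.compl_sets[OF A] by (simp add: Compl_eq_Diff_UNIV)
    then show "(\<lambda>\<eta>. ennreal (1 / rpow (dist \<xi> \<eta>) D) * indicator (- A) \<eta>) \<in> borel_measurable \<nu>"
      using kernel_measurable by (intro borel_measurable_times_ennreal borel_measurable_indicator)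
  qed
  also have "\<dots> \<le> J"
    unfolding J_def
  proof (rule nn_integral_mono)
    fix \<eta>
    show "ennreal (t / 2 powr p) * (ennreal (1 / rpow (dist \<xi> \<eta>) D) * indicator (- A) \<eta>)
        \<le> ennreal (norm (f \<xi> - f \<eta>) powr p / rpow (dist \<xi> \<eta>) D)"
    proof (cases "\<eta> \<in> A")
      case False
      then have "s / 2 \<le> norm (f \<xi> - f \<eta>)"
        using norm_triangle_ineq2[of "f \<xi>" "f \<eta>"] by (simp add: A_def s_def)
      then have "t / 2 powr p \<le> norm (f \<xi> - f \<eta>) powr p"
        using s p unfolding half[symmetric] by (intro powr_mono2) auto
      moreover have nn: "0 \<le> rpow (dist \<xi> \<eta>) D" by (simp add: rpow_def)
      ultimately have "t / 2 powr p / rpow (dist \<xi> \<eta>) D \<le> norm (f \<xi> - f \<eta>) powr p / rpow (dist \<xi> \<eta>) D"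
        by (rule divide_right_mono)
      then show ?thesis
        using False t nn by (simp add: ennreal_mult'[symmetric] ennreal_leI)
    qed simp
  qed
  finally have J: "ennreal (t / 2 powr p) * ennreal b \<le> J" .
  have K: "K = \<bar>ln \<kappa>\<bar> + 4 * 2 powr p * ln (2 * C' / c) / c" by (simp add: K_def \<kappa>_def)
  have K2: "0 \<le> 4 * 2 powr p * ln (2 * C' / c) / c" using q c_pos by simp
  then have K_nonneg: "0 \<le> K" by (simp add: K)
  (* b may be negative, and ennreal truncates it; the real estimate has to use its positive part. *)
  have "log_plus (t / a) \<le> K + K * (max 0 b / 2 powr p)"
  proof (cases "t / a \<le> 1")
    case True
    then show ?thesis using t a K_nonneg by (simp add: log_plus_def)
  next
    case False
    have "log_plus (t / a) = ln (t / a)" using False t a by (simp add: log_plus_def del: ln_div)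
    also have "\<dots> = ln (\<kappa> * (t / a)) - ln \<kappa>"
      using \<kappa> t a ln_mult_pos[of \<kappa> "t / a"] by (simp del: ln_div)
    also have "ln (\<kappa> * (t / a)) = 4 * 2 powr p * ln (2 * C' / c) / c * (b / 2 powr p)"
      using q c_pos by (simp add: b_def del: ln_div)
    also have "\<dots> \<le> 4 * 2 powr p * ln (2 * C' / c) / c * (max 0 b / 2 powr p)"
      by (rule mult_left_mono[OF _ K2]) (simp add: divide_right_mono)
    also have "\<dots> \<le> K * (max 0 b / 2 powr p)"
      by (rule mult_right_mono) (simp_all add: K)
    finally show ?thesis using K K2 by linarith
  qed
  then have "t * log_plus (t / a) \<le> t * (K + K * (max 0 b / 2 powr p))"
    using t by (intro mult_left_mono) auto
  also have "\<dots> = K * (t + t / 2 powr p * max 0 b)" by (simp add: algebra_simps)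
  finally have "ennreal (t * log_plus (t / a)) \<le> ennreal (K * (t + t / 2 powr p * max 0 b))"
    by (rule ennreal_leI)
  also have "\<dots> = ennreal K * (ennreal t + ennreal (t / 2 powr p) * ennreal (max 0 b))"
  proof -
    have "ennreal (t / 2 powr p) * ennreal (max 0 b) = ennreal (t / 2 powr p * max 0 b)"
      using t by (intro ennreal_mult[symmetric]) auto
    then have "ennreal t + ennreal (t / 2 powr p) * ennreal (max 0 b) = ennreal (t + t / 2 powr p * max 0 b)"
      using t by (simp add: ennreal_plus)
    moreover have "ennreal (K * (t + t / 2 powr p * max 0 b)) = ennreal K * ennreal (t + t / 2 powr p * max 0 b)"
      using t K_nonneg by (intro ennreal_mult) auto
    ultimately show ?thesis by simp
  qed
  also have "ennreal (max 0 b) = ennreal b" by (simp add: max_def ennreal_neg)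
  also have "ennreal K * (ennreal t + ennreal (t / 2 powr p) * ennreal b) \<le> ennreal K * (ennreal t + J)"
    using J by (intro mult_left_mono add_left_mono) auto
  finally show ?thesis by (simp add: t_def s_def J_def)
qed

lemma pointwise_log_bound:
  assumes p: "1 \<le> p"
  obtains K where "0 < K"
    "\<And>(f :: 'a \<Rightarrow> complex) a \<xi>. f \<in> borel_measurable \<nu> \<Longrightarrow> 0 < a \<Longrightarrow>
      (\<integral>\<^sup>+\<eta>. ennreal (norm (f \<eta>) powr p) \<partial>\<nu>) = ennreal a \<Longrightarrow>
      ennreal (norm (f \<xi>) powr p * log_plus (norm (f \<xi>) powr p / a))
        \<le> ennreal K * (ennreal (norm (f \<xi>) powr p)
            + (\<integral>\<^sup>+\<eta>. ennreal (norm (f \<xi> - f \<eta>) powr p / rpow (dist \<xi> \<eta>) D) \<partial>\<nu>))"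
proof (cases "D = 0")
  case True
  have "0 \<le> ln (1 / c)" using c_pos c_le_1 by simp
  show ?thesis
  proof (rule that[of "1 + ln (1 / c)"])
    show "0 < 1 + ln (1 / c)" using \<open>0 \<le> ln (1 / c)\<close> by linarith
    fix f :: "'a \<Rightarrow> complex" and a \<xi>
    assume "0 < a" "(\<integral>\<^sup>+\<eta>. ennreal (norm (f \<eta>) powr p) \<partial>\<nu>) = ennreal a"
    then have "norm (f \<xi>) powr p * log_plus (norm (f \<xi>) powr p / a) \<le> ln (1 / c) * norm (f \<xi>) powr p"
      using pointwise_log_bound_atomic[OF True] by blast
    also have "\<dots> \<le> (1 + ln (1 / c)) * norm (f \<xi>) powr p"
      by (intro mult_right_mono) auto
    finally have "ennreal (norm (f \<xi>) powr p * log_plus (norm (f \<xi>) powr p / a))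
        \<le> ennreal (1 + ln (1 / c)) * ennreal (norm (f \<xi>) powr p)"
      using \<open>0 \<le> ln (1 / c)\<close> by (subst ennreal_mult[symmetric]) (auto intro: ennreal_leI)
    also have "\<dots> \<le> ennreal (1 + ln (1 / c)) * (ennreal (norm (f \<xi>) powr p)
            + (\<integral>\<^sup>+\<eta>. ennreal (norm (f \<xi> - f \<eta>) powr p / rpow (dist \<xi> \<eta>) D) \<partial>\<nu>))"
      by (intro mult_left_mono) auto
    finally show "ennreal (norm (f \<xi>) powr p * log_plus (norm (f \<xi>) powr p / a)) \<le> \<dots>" .
  qed
next
  case False
  then have D: "0 < D" using D_nonneg by simp
  define K where "K = \<bar>ln (c * \<Delta> powr D / (4 * 2 powr p))\<bar> + 4 * 2 powr p * ln (2 * C' / c) / c"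
  have "1 < 2 * C' / c" using c_pos c_le_1 C'_ge_1 by (simp add: field_simps)
  then have "0 < 4 * 2 powr p * ln (2 * C' / c) / c" using c_pos by simp
  then have "0 < K" unfolding K_def by linarith
  then show ?thesis
    using that[of K] pointwise_log_bound_diffuse[OF D p] unfolding K_def by blast
qed

lemma difference_quotient_measurable:
  fixes f :: "'a \<Rightarrow> complex"
  assumes f: "f \<in> borel_measurable \<nu>" and mass: "emeasure \<nu> UNIV \<noteq> 0"
  shows "(\<lambda>(\<xi>, \<eta>). ennreal (norm (f \<xi> - f \<eta>) powr p / rpow (dist \<xi> \<eta>) D))
    \<in> borel_measurable (\<nu> \<Otimes>\<^sub>M \<nu>)"
proof -
  have [measurable]: "f \<in> borel_measurable \<nu>" by fact
  have [measurable]: "(\<lambda>z. dist (fst z) (snd z)) \<in> borel_measurable (\<nu> \<Otimes>\<^sub>M \<nu>)"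
    using dist_measurable[OF mass] by (simp add: case_prod_unfold)
  have [measurable]: "(\<lambda>z. rpow (dist (fst z) (snd z)) D) \<in> borel_measurable (\<nu> \<Otimes>\<^sub>M \<nu>)"
    unfolding rpow_def by measurable
  show ?thesis unfolding case_prod_unfold by measurable
qed

end

section \<open>The logarithmic inequality\<close>

theorem theorem4p1:
  fixes \<nu> :: "'a::metric_space measure" and D p :: real
  assumes "metric_measure_space \<nu>"
    and "bounded (UNIV :: 'a set)"
    and "Ahlfors_David_regular \<nu> D"
    and "1 \<le> p"
  shows "\<exists>C::real. C > 0 \<and>
    (\<forall>f :: 'a \<Rightarrow> complex. f \<in> borel_measurable \<nu> \<longrightarrow>
       log_integral \<nu> p f
         \<le> ennreal C * (ennreal_powr (Lp_norm \<nu> p f) p + double_integral \<nu> D p f))"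
proof -
  obtain c C' where reg: "0 \<le> D" "0 < c" "c \<le> 1" "1 \<le> C'"
    "\<forall>\<xi>. \<forall>r\<in>{0..diameter (UNIV :: 'a set)}.
       ennreal (c * rpow r D) \<le> emeasure \<nu> (cball \<xi> r) \<and> emeasure \<nu> (cball \<xi> r) \<le> ennreal (C' * rpow r D)"
    using assms(3) unfolding Ahlfors_David_regular_def by blast
  interpret regular_measure \<nu> D c C' "diameter (UNIV :: 'a set)"
    using reg assms(1,2) diameter_bounded_bound[OF assms(2)]
    by unfold_locales (auto simp: metric_measure_space_def)
  obtain K where K: "0 < K"
    "\<And>(f :: 'a \<Rightarrow> complex) a \<xi>. f \<in> borel_measurable \<nu> \<Longrightarrow> 0 < a \<Longrightarrow>
      (\<integral>\<^sup>+\<eta>. ennreal (norm (f \<eta>) powr p) \<partial>\<nu>) = ennreal a \<Longrightarrow>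
      ennreal (norm (f \<xi>) powr p * log_plus (norm (f \<xi>) powr p / a))
        \<le> ennreal K * (ennreal (norm (f \<xi>) powr p)
            + (\<integral>\<^sup>+\<eta>. ennreal (norm (f \<xi> - f \<eta>) powr p / rpow (dist \<xi> \<eta>) D) \<partial>\<nu>))"
    using pointwise_log_bound[OF assms(4)] by blast
  show ?thesis
  proof (intro exI[of _ K] conjI allI impI K(1))
    fix f :: "'a \<Rightarrow> complex" assume f: "f \<in> borel_measurable \<nu>"
    define I where "I = (\<integral>\<^sup>+\<eta>. ennreal (norm (f \<eta>) powr p) \<partial>\<nu>)"
    consider "I = \<infinity>" | "I = 0" | a where "0 < a" "I = ennreal a"
      by (cases I) (auto simp: less_le)
    then show "log_integral \<nu> p f
        \<le> ennreal K * (ennreal_powr (Lp_norm \<nu> p f) p + double_integral \<nu> D p f)"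
    proof cases
      case 1
      then show ?thesis
        using K(1) by (simp add: Lp_norm_def ennreal_powr_def I_def[symmetric] ennreal_mult_top)
    next
      case 2
      then have "log_integral \<nu> p f = 0"
        by (simp add: log_integral_def Lp_norm_def ennreal_powr_def I_def[symmetric] log_plus_def)
      then show ?thesis by simp
    next
      case (3 a)
      let ?J = "\<lambda>\<xi>. \<integral>\<^sup>+\<eta>. ennreal (norm (f \<xi> - f \<eta>) powr p / rpow (dist \<xi> \<eta>) D) \<partial>\<nu>"
      have norm: "Lp_norm \<nu> p f = ennreal (a powr (1 / p))"
        using 3 by (simp add: Lp_norm_def ennreal_powr_def I_def[symmetric])
      have a_eq: "(a powr (1 / p)) powr p = a" using 3 assms(4) by (simp add: powr_powr)
      have "emeasure \<nu> UNIV \<noteq> 0"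
        using 3 by (intro mass_pos_of_integral_pos[of "\<lambda>\<eta>. ennreal (norm (f \<eta>) powr p)"]) (simp add: I_def)
      then have quot: "(\<lambda>(\<xi>, \<eta>). ennreal (norm (f \<xi> - f \<eta>) powr p / rpow (dist \<xi> \<eta>) D))
          \<in> borel_measurable (\<nu> \<Otimes>\<^sub>M \<nu>)"
        by (rule difference_quotient_measurable[OF f])
      have J: "?J \<in> borel_measurable \<nu>"
        using quot by (rule borel_measurable_nn_integral)
      have double: "double_integral \<nu> D p f = (\<integral>\<^sup>+\<xi>. ?J \<xi> \<partial>\<nu>)"
        using nn_integral_fst[OF quot] by (simp add: double_integral_def)
      have "log_integral \<nu> p f = (\<integral>\<^sup>+\<xi>. ennreal (norm (f \<xi>) powr p * log_plus (norm (f \<xi>) powr p / a)) \<partial>\<nu>)"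
        by (simp add: log_integral_def norm a_eq)
      also have "\<dots> \<le> (\<integral>\<^sup>+\<xi>. ennreal K * (ennreal (norm (f \<xi>) powr p) + ?J \<xi>) \<partial>\<nu>)"
        using K(2)[OF f] 3 by (intro nn_integral_mono) (simp add: I_def)
      also have "\<dots> = ennreal K * ((\<integral>\<^sup>+\<xi>. ennreal (norm (f \<xi>) powr p) \<partial>\<nu>) + (\<integral>\<^sup>+\<xi>. ?J \<xi> \<partial>\<nu>))"
        using J f by (subst nn_integral_cmult) (auto simp: nn_integral_add)
      also have "\<dots> = ennreal K * (ennreal_powr (Lp_norm \<nu> p f) p + double_integral \<nu> D p f)"
        using 3 by (simp add: double norm ennreal_powr_def a_eq I_def)
      finally show ?thesis .
    qed
  qed
qed

end
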